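(* Let $\rho,\sigma,\delta>0$. Then the mapping $x\mapsto\phi_{\rho,\sigma,\delta}(x)$ is differentiable at every $x\in X$, with gradient $$\nabla\phi_{\rho,\sigma,\delta}(x)=\nabla_xF\bigl(x,y_{\rho,\sigma,\delta}^*(x)\bigr)-\rho\nabla_xf\bigl(x,y_{\rho,\sigma,\delta}^*(x)\bigr)+\rho\nabla_xf\bigl(x,z_{\rho,\sigma,\delta}^*(x)\bigr),$$ where $(y_{\rho,\sigma,\delta}^*(x),z_{\rho,\sigma,\delta}^*(x))$ is the unique saddle point of the minimax problem $\min_{z\in Y}\max_{y\in Y}\psi_{\rho,\sigma,\delta}(x,y,z)$ defining $\phi_{\rho,\sigma,\delta}(x)$.
   Context: $X\subseteq\mathbb R^n$ and $Y\subseteq\mathbb R^m$ are nonempty, closed and convex, and $F,f:\mathbb R^n\times\mathbb R^m\to\mathbb R$. For $x\in X$ let $\mathcal S(x):=\arg\min_{y\in Y}f(x,y)$. Standing assumptions. (A1) $F$ is continuously differentiable and $\nabla F$ is Lipschitz continuous on $X\times Y$. For every $x\in X$, $F(x,\cdot)$ is concave on $Y$ and $-F(x,\cdot)$ is coercive on $Y$, i.e. $\lim_{\|y\|\to\infty,\,y\in Y}F(x,y)=-\infty$. (A2) $f$ is continuously differentiable and $\nabla f$ is Lipschitz continuous on $X\times Y$. For every $x\in X$, $f(x,\cdot)$ is convex on $Y$ and $\mathcal S(x)\neq\emptyset$. For every bounded set $D_x\subseteq X$ there is a bounded set $D_y\subseteq Y$ with $\mathcal S(x)\cap D_y\neq\emptyset$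 for every $x\in D_x$. For $\rho,\sigma,\delta>0$ define $$\psi_{\rho,\sigma,\delta}(x,y,z):=F(x,y)-\rho\bigl(f(x,y)-f(x,z)\bigr)+\frac{\sigma}{2}\|z\|^2-\sigma\langle y,z\rangle-\frac{\delta}{2}\|y\|^2,$$ $$\phi_{\rho,\sigma,\delta}(x):=\min_{z\in Y}\max_{y\in Y}\psi_{\rho,\sigma,\delta}(x,y,z)=\max_{y\in Y}\min_{z\in Y}\psi_{\rho,\sigma,\delta}(x,y,z),\qquad x\in X.$$ For each $x\in X$, $\psi_{\rho,\sigma,\delta}(x,\cdot,\cdot)$ is $\delta$-strongly concave in $y$ and $\sigma$-strongly convex in $z$ on $Y$, and has a unique saddle point $(y_{\rho,\sigma,\delta}^*(x),z_{\rho,\sigma,\delta}^*(x))\in Y\times Y$ (maximizing in $y$, minimizing in $z$). *)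

theory Defs
  imports "HOL-Analysis.Analysis"
begin

text \<open>Meaningful where the function is differentiable, in which case the gradient is unique.\<close>

definition gradient :: "('a::euclidean_space \<Rightarrow> real) \<Rightarrow> 'a \<Rightarrow> 'a" where
  "gradient g p = (THE D. GDERIV g p :> D)"

definition gradient_x ::
  "('a::euclidean_space \<times> 'b::euclidean_space \<Rightarrow> real) \<Rightarrow> 'a \<Rightarrow> 'b \<Rightarrow> 'a" where
  "gradient_x g x y = gradient (\<lambda>x'. g (x', y)) x"

definition continuously_differentiable :: "('a::euclidean_space \<Rightarrow> real) \<Rightarrow> bool" where
  "continuously_differentiable g \<longleftrightarrow>
     (\<forall>p. g differentiable (at p)) \<and> continuous_on UNIV (gradient g)"

definition argmin_set ::
  "('a::euclidean_space \<times> 'b::euclidean_space \<Rightarrow> real) \<Rightarrow> 'b set \<Rightarrow> 'a \<Rightarrow> 'b set" where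
  "argmin_set f Y x = {y. is_arg_min (\<lambda>y. f (x, y)) (\<lambda>y. y \<in> Y) y}"

definition assumption_A1 ::
  "'a::euclidean_space set \<Rightarrow> 'b::euclidean_space set \<Rightarrow> ('a \<times> 'b \<Rightarrow> real) \<Rightarrow> bool" where
  "assumption_A1 X Y F \<longleftrightarrow>
     continuously_differentiable F \<and>
     (\<exists>L. L-lipschitz_on (X \<times> Y) (gradient F)) \<and>
     (\<forall>x\<in>X. concave_on Y (\<lambda>y. F (x, y)) \<and>
        filterlim (\<lambda>y. F (x, y)) at_bot (inf at_infinity (principal Y)))"

definition assumption_A2 ::
  "'a::euclidean_space set \<Rightarrow> 'b::euclidean_space set \<Rightarrow> ('a \<times> 'b \<Rightarrow> real) \<Rightarrow> bool" where
  "assumption_A2 X Y f \<longleftrightarrow>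
     continuously_differentiable f \<and>
     (\<exists>L. L-lipschitz_on (X \<times> Y) (gradient f)) \<and>
     (\<forall>x\<in>X. convex_on Y (\<lambda>y. f (x, y)) \<and> argmin_set f Y x \<noteq> {}) \<and>
     (\<forall>Dx. bounded Dx \<and> Dx \<subseteq> X \<longrightarrow>
        (\<exists>Dy. bounded Dy \<and> Dy \<subseteq> Y \<and> (\<forall>x\<in>Dx. argmin_set f Y x \<inter> Dy \<noteq> {})))"

definition psi ::
  "('a::euclidean_space \<times> 'b::euclidean_space \<Rightarrow> real) \<Rightarrow> ('a \<times> 'b \<Rightarrow> real) \<Rightarrow>
     real \<Rightarrow> real \<Rightarrow> real \<Rightarrow> 'a \<Rightarrow> 'b \<Rightarrow> 'b \<Rightarrow> real" where
  "psi F f \<rho> \<sigma> \<delta> x y z =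
     F (x, y) - \<rho> * (f (x, y) - f (x, z)) + \<sigma> / 2 * (norm z)\<^sup>2 - \<sigma> * (y \<bullet> z)
       - \<delta> / 2 * (norm y)\<^sup>2"

text \<open>Under the two assumptions and for positive parameters, the supremum over \<open>y\<close> is attained
  for every \<open>z\<close>, and the infimum over \<open>z\<close> is attained at the saddle point; the real-valued
  \<open>SUP\<close> and \<open>INF\<close> are therefore the maximum and the minimum.\<close>

definition phi ::
  "'b::euclidean_space set \<Rightarrow> ('a::euclidean_space \<times> 'b \<Rightarrow> real) \<Rightarrow> ('a \<times> 'b \<Rightarrow> real) \<Rightarrow>
     real \<Rightarrow> real \<Rightarrow> real \<Rightarrow> 'a \<Rightarrow> real" where
  "phi Y F f \<rho> \<sigma> \<delta> x = (INF z\<in>Y. SUP y\<in>Y. psi F f \<rho> \<sigma> \<delta> x y z)"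

definition is_saddle_point :: "'b set \<Rightarrow> ('b \<Rightarrow> 'b \<Rightarrow> real) \<Rightarrow> 'b \<times> 'b \<Rightarrow> bool" where
  "is_saddle_point Y g p \<longleftrightarrow>
     fst p \<in> Y \<and> snd p \<in> Y \<and>
     (\<forall>y\<in>Y. g y (snd p) \<le> g (fst p) (snd p)) \<and>
     (\<forall>z\<in>Y. g (fst p) (snd p) \<le> g (fst p) z)"

definition saddle_point ::
  "'b::euclidean_space set \<Rightarrow> ('a::euclidean_space \<times> 'b \<Rightarrow> real) \<Rightarrow> ('a \<times> 'b \<Rightarrow> real) \<Rightarrow>
     real \<Rightarrow> real \<Rightarrow> real \<Rightarrow> 'a \<Rightarrow> 'b \<times> 'b" where
  "saddle_point Y F f \<rho> \<sigma> \<delta> x = (THE p. is_saddle_point Y (psi F f \<rho> \<sigma> \<delta> x) p)"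

definition y_star ::
  "'b::euclidean_space set \<Rightarrow> ('a::euclidean_space \<times> 'b \<Rightarrow> real) \<Rightarrow> ('a \<times> 'b \<Rightarrow> real) \<Rightarrow>
     real \<Rightarrow> real \<Rightarrow> real \<Rightarrow> 'a \<Rightarrow> 'b" where
  "y_star Y F f \<rho> \<sigma> \<delta> x = fst (saddle_point Y F f \<rho> \<sigma> \<delta> x)"

definition z_star ::
  "'b::euclidean_space set \<Rightarrow> ('a::euclidean_space \<times> 'b \<Rightarrow> real) \<Rightarrow> ('a \<times> 'b \<Rightarrow> real) \<Rightarrow>
     real \<Rightarrow> real \<Rightarrow> real \<Rightarrow> 'a \<Rightarrow> 'b" where
  "z_star Y F f \<rho> \<sigma> \<delta> x = snd (saddle_point Y F f \<rho> \<sigma> \<delta> x)"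

text \<open>The derivative is taken within \<open>S\<close>. At interior points of \<open>S\<close> this is
  \<open>GDERIV g x :> D\<close>; at other points only increments staying in \<open>S\<close> matter.\<close>

definition has_gradient_within ::
  "('a::euclidean_space \<Rightarrow> real) \<Rightarrow> 'a \<Rightarrow> 'a \<Rightarrow> 'a set \<Rightarrow> bool" where
  "has_gradient_within g D x S \<longleftrightarrow> (g has_derivative (\<lambda>h. h \<bullet> D)) (at x within S)"

end

theory Submission
  imports Defs
begin

text \<open>For fixed \<open>x\<close> the function \<open>\<psi>\<close> is a concave function of \<open>y\<close> plus a convex function of \<open>z\<close>,
  plus quadratic terms whose bilinear part \<open>- \<sigma> \<langle>y, z\<rangle>\<close> is skew for the saddle operator
  \<open>M\<^sub>x(y, z) = (- \<nabla>\<^sub>y \<psi>, \<nabla>\<^sub>z \<psi>)\<close>. Hence \<open>M\<^sub>x\<close> is strongly monotone and Lipschitz on \<open>Y \<times> Y\<close>, and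
  a projected step is a contraction; its fixed point solves the variational inequality of
  \<open>M\<^sub>x\<close> and is the saddle point. Strong monotonicity also makes the saddle point Lipschitz
  in \<open>x\<close>. Finally, the saddle inequalities sandwich \<open>\<phi> x' - \<phi> x\<close> between increments of
  \<open>\<psi>\<close> in its first argument alone, both of which agree with the claimed linear form up to
  \<open>O(\<parallel>x' - x\<parallel>\<^sup>2)\<close>.\<close>

section \<open>Gradients\<close>

lemma GDERIV_gradient:
  assumes "g differentiable (at p)"
  shows "GDERIV g p :> gradient g p"
proof -
  obtain D where D: "(g has_derivative D) (at p)"
    using assms by (auto simp: differentiable_def)
  \<comment> \<open>Riesz representation: the adjoint maps the scalar 1 to the vector representing
    the functional \<open>D\<close>.\<close>
  have "D = (\<lambda>h. h \<bullet> adjoint D 1)"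
    by (simp add: adjoint_works[OF has_derivative_linear[OF D]])
  with D have ex: "GDERIV g p :> adjoint D 1"
    unfolding gderiv_def by metis
  moreover have "d = adjoint D 1" if "GDERIV g p :> d" for d
    using has_derivative_unique[OF that[unfolded gderiv_def] ex[unfolded gderiv_def]]
    by (metis vector_eq_ldot)
  ultimately show ?thesis
    unfolding gradient_def by (rule theI)
qed

lemma gradient_eqI:
  assumes "GDERIV g p :> D"
  shows "gradient g p = D"
proof -
  have "GDERIV g p :> gradient g p"
    using assms by (intro GDERIV_gradient) (auto simp: differentiable_def gderiv_def)
  then show ?thesis
    using assms has_derivative_unique unfolding gderiv_def by (metis vector_eq_ldot)
qed

lemma GDERIV_Pair_fst:
  assumes "GDERIV g (x, y) :> D"
  shows "GDERIV (\<lambda>x'. g (x', y)) x :> fst D"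
proof -
  have "((\<lambda>x'. (x', y)) has_derivative (\<lambda>h. (h, 0))) (at x)"
    by (auto intro!: derivative_eq_intros)
  from has_derivative_compose[OF this assms[unfolded gderiv_def]]
  show ?thesis by (simp add: gderiv_def inner_prod_def)
qed

lemma GDERIV_Pair_snd:
  assumes "GDERIV g (x, y) :> D"
  shows "GDERIV (\<lambda>y'. g (x, y')) y :> snd D"
proof -
  have "((\<lambda>y'. (x, y')) has_derivative (\<lambda>h. (0, h))) (at y)"
    by (auto intro!: derivative_eq_intros)
  from has_derivative_compose[OF this assms[unfolded gderiv_def]]
  show ?thesis by (simp add: gderiv_def inner_prod_def)
qed

lemma gradient_x_eq:
  assumes "g differentiable (at (x, y))"
  shows "gradient_x g x y = fst (gradient g (x, y))"
  unfolding gradient_x_def by (intro gradient_eqI GDERIV_Pair_fst GDERIV_gradient assms)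

text \<open>Along the segment from \<open>y\<close> to \<open>y'\<close>, convexity bounds the
  difference quotient at 0 from the right by \<open>h y' - h y\<close>; its limit is the directional
  derivative.\<close>

lemma convex_on_above_gradient:
  assumes h: "convex_on S h" and D: "GDERIV h y :> D" and S: "y \<in> S" "y' \<in> S"
  shows "h y + (y' - y) \<bullet> D \<le> h y'"
proof -
  define g where "g t = h (y + t *\<^sub>R (y' - y))" for t :: real
  have "((\<lambda>t::real. y + t *\<^sub>R (y' - y)) has_derivative (\<lambda>s. s *\<^sub>R (y' - y))) (at 0)"
    by (auto intro!: derivative_eq_intros)
  moreover have "(h has_derivative (\<lambda>h. h \<bullet> D)) (at (y + 0 *\<^sub>R (y' - y)))"
    using D by (simp add: gderiv_def)
  ultimately have "(g has_real_derivative (y' - y) \<bullet> D) (at 0)"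
    unfolding g_def has_field_derivative_def
    by (rule has_derivative_compose[THEN has_derivative_eq_rhs]) (auto simp: mult.commute)
  then have "((\<lambda>t. (g t - g 0) / t) \<longlongrightarrow> (y' - y) \<bullet> D) (at_right 0)"
    by (auto simp: has_field_derivative_iff intro: tendsto_within_subset)
  moreover have "\<forall>\<^sub>F t in at_right 0. (g t - g 0) / t \<le> h y' - h y"
    using eventually_at_right_real[OF zero_less_one]
  proof eventually_elim
    case (elim t)
    have "g t \<le> (1 - t) * h y + t * h y'"
      using convex_onD[OF h, of t y y'] elim S by (simp add: g_def algebra_simps)
    then show ?case
      using elim by (simp add: g_def field_simps)
  qed
  ultimately have "(y' - y) \<bullet> D \<le> h y' - h y"
    by (intro tendsto_upperbound) auto
  then show ?thesis by simp
qed

lemma convex_on_gradient_mono: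
  assumes "convex_on S h" "GDERIV h y :> D" "GDERIV h y' :> D'" "y \<in> S" "y' \<in> S"
  shows "0 \<le> (D - D') \<bullet> (y - y')"
  using convex_on_above_gradient[OF assms(1,2,4,5)] convex_on_above_gradient[OF assms(1,3,5,4)]
  by (simp add: inner_commute inner_diff_left inner_diff_right)

lemma concave_on_below_gradient:
  assumes "concave_on S h" "GDERIV h y :> D" "y \<in> S" "y' \<in> S"
  shows "h y' \<le> h y + (y' - y) \<bullet> D"
  using convex_on_above_gradient[OF assms(1)[unfolded concave_on_def] GDERIV_minus[OF assms(2)] assms(3,4)]
  by simp

lemma concave_on_gradient_antimono:
  assumes "concave_on S h" "GDERIV h y :> D" "GDERIV h y' :> D'" "y \<in> S" "y' \<in> S"
  shows "(D - D') \<bullet> (y - y') \<le> 0"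
  using concave_on_below_gradient[OF assms(1,2,4,5)] concave_on_below_gradient[OF assms(1,3,5,4)]
  by (simp add: inner_commute inner_diff_left inner_diff_right)

text \<open>Mean value inequality on the segment from \<open>x\<close> to \<open>x'\<close> for
  \<open>g (s, u)\<close> minus a linear form frozen at \<open>(x, y)\<close>. Allowing
  \<open>u\<close> to differ from \<open>y\<close> lets increments at perturbed saddle points be
  compared with one fixed linear form.\<close>

lemma lipschitz_gradient_partial_increment:
  assumes X: "convex X" "x \<in> X" "x' \<in> X" and Y: "y \<in> Y" "u \<in> Y"
    and g: "\<And>p. p \<in> X \<times> Y \<Longrightarrow> GDERIV g p :> D p"
    and L: "L-lipschitz_on (X \<times> Y) D"
  shows "\<bar>g (x', u) - g (x, u) - (x' - x) \<bullet> fst (D (x, y))\<bar>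
    \<le> L * (norm (x' - x) + norm (u - y)) * norm (x' - x)"
proof -
  have L0: "0 \<le> L" using L by (rule lipschitz_on_nonneg)
  define k where "k s = g (s, u) - s \<bullet> fst (D (x, y))" for s
  have "norm (k x' - k x) \<le> L * (norm (x' - x) + norm (u - y)) * norm (x' - x)"
  proof (rule differentiable_bound[of "closed_segment x x'" k
        "\<lambda>s h. h \<bullet> (fst (D (s, u)) - fst (D (x, y)))"])
    fix s assume s: "s \<in> closed_segment x x'"
    with X have sX: "s \<in> X" using closed_segment_subset by blast
    have "((\<lambda>s. g (s, u)) has_derivative (\<lambda>h. h \<bullet> fst (D (s, u)))) (at s)"
      using GDERIV_Pair_fst[OF g] sX Y by (simp add: gderiv_def)
    then show "(k has_derivative (\<lambda>h. h \<bullet> (fst (D (s, u)) - fst (D (x, y)))))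
        (at s within closed_segment x x')"
      unfolding k_def inner_diff_right
      by (rule has_derivative_at_withinI[OF has_derivative_diff
            [OF _ bounded_linear_imp_has_derivative[OF bounded_linear_inner_left]]])
    have "norm (fst (D (s, u)) - fst (D (x, y))) \<le> norm (D (s, u) - D (x, y))"
      by (metis norm_fst_le prod.collapse fst_diff)
    also have "\<dots> \<le> L * norm ((s, u) - (x, y))"
      using L sX X Y by (intro lipschitz_on_normD) auto
    also have "\<dots> \<le> L * (norm (s - x) + norm (u - y))"
      using norm_Pair_le[of "s - x" "u - y"] L0 by (auto intro: mult_left_mono)
    also have "\<dots> \<le> L * (norm (x' - x) + norm (u - y))"
      using segment_bound1[OF s] L0 by (intro mult_left_mono) auto
    finally have "norm (fst (D (s, u)) - fst (D (x, y))) \<le> L * (norm (x' - x) + norm (u - y))" .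
    moreover have "onorm (\<lambda>h. h \<bullet> (fst (D (s, u)) - fst (D (x, y))))
        \<le> norm (fst (D (s, u)) - fst (D (x, y)))"
      by (intro onorm_bound norm_ge_zero) (metis Cauchy_Schwarz_ineq2 mult.commute real_norm_def)
    ultimately show "onorm (\<lambda>h. h \<bullet> (fst (D (s, u)) - fst (D (x, y))))
        \<le> L * (norm (x' - x) + norm (u - y))"
      by linarith
  qed auto
  then show ?thesis
    by (simp add: k_def inner_diff_left algebra_simps)
qed

section \<open>Strongly monotone variational inequalities\<close>

lemma strongly_monotone_variational_inequality:
  fixes M :: "'c::euclidean_space \<Rightarrow> 'c"
  assumes S: "closed S" "convex S" "S \<noteq> {}"
    and lip: "K-lipschitz_on S M" and \<mu>: "0 < \<mu>"
    and mono: "\<And>w w'. w \<in> S \<Longrightarrow> w' \<in> S \<Longrightarrow> \<mu> * (norm (w - w'))\<^sup>2 \<le> (M w - M w') \<bullet> (w - w')"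
  obtains w where "w \<in> S" "\<And>v. v \<in> S \<Longrightarrow> 0 \<le> M w \<bullet> (v - w)"
proof -
  \<comment> \<open>Enlarging the Lipschitz constant makes it positive and at least
    \<open>\<mu>\<close>, so the square root defining \<open>c\<close> has a nonnegative
    argument.\<close>
  define N where "N = max K \<mu>"
  have N: "0 < N" "\<mu> \<le> N" "N-lipschitz_on S M"
    using \<mu> lipschitz_on_le[OF lip, of N] by (auto simp: N_def)
  \<comment> \<open>A projected step of length t has squared contraction factor at most
    \<open>1 - 2 * t * \<mu> + t\<^sup>2 * N\<^sup>2\<close>. This \<open>\<tau>\<close> is the
    minimizer in t, with minimum \<open>c\<^sup>2\<close>.\<close>
  define \<tau> where "\<tau> = \<mu> / N\<^sup>2"
  define T where "T w = closest_point S (w - \<tau> *\<^sub>R M w)" for w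
  have \<tau>: "0 < \<tau>" using N \<mu> by (simp add: \<tau>_def)
  define c where "c = sqrt (1 - \<mu>\<^sup>2 / N\<^sup>2)"
  have "\<mu>\<^sup>2 / N\<^sup>2 \<le> 1" using N \<mu> by (simp add: power_mono)
  then have c: "0 \<le> c" "c < 1" "c\<^sup>2 = 1 - \<mu>\<^sup>2 / N\<^sup>2"
    using N \<mu> by (auto simp: c_def)
  have "T ` S \<subseteq> S"
    unfolding T_def using closest_point_in_set[OF S(1,3)] by blast
  have "\<exists>!w\<in>S. T w = w"
  proof (rule Banach_fix)
    fix w w' assume w: "w \<in> S" "w' \<in> S"
    define d where "d = w - w'"
    define e where "e = M w - M w'"
    have e: "\<mu> * (norm d)\<^sup>2 \<le> e \<bullet> d" "norm e \<le> N * norm d"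
      using mono[OF w] lipschitz_on_normD[OF N(3) w] by (auto simp: d_def e_def)
    have "(norm (d - \<tau> *\<^sub>R e))\<^sup>2 = (norm d)\<^sup>2 - 2 * \<tau> * (e \<bullet> d) + \<tau>\<^sup>2 * (norm e)\<^sup>2"
      by (simp only: power2_norm_eq_inner)
        (simp add: algebra_simps inner_commute power2_eq_square inner_diff_left inner_diff_right)
    also have "\<dots> \<le> (norm d)\<^sup>2 - 2 * \<tau> * (\<mu> * (norm d)\<^sup>2) + \<tau>\<^sup>2 * (N * norm d)\<^sup>2"
      using e \<tau> by (intro add_mono diff_mono mult_left_mono power_mono) auto
    also have "\<dots> = c\<^sup>2 * (norm d)\<^sup>2"
      using N unfolding c(3) \<tau>_def by (simp add: field_simps power2_eq_square)
    finally have "norm (d - \<tau> *\<^sub>R e) \<le> c * norm d"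
      by (intro power2_le_imp_le[OF _ mult_nonneg_nonneg]) (simp_all add: power_mult_distrib c(1))
    moreover have "dist (T w) (T w') \<le> norm (d - \<tau> *\<^sub>R e)"
      unfolding T_def using closest_point_lipschitz[OF S(2,1,3)]
      by (rule order_trans) (simp add: dist_norm d_def e_def algebra_simps)
    ultimately show "dist (T w) (T w') \<le> c * dist w w'"
      by (simp add: dist_norm d_def)
  qed (use S c(1,2) \<open>T ` S \<subseteq> S\<close> in \<open>simp_all add: complete_eq_closed\<close>)
  then obtain w where w: "w \<in> S" "closest_point S (w - \<tau> *\<^sub>R M w) = w"
    unfolding T_def by (elim ex1E conjE)
  \<comment> \<open>Since \<open>w\<close> is the projection of
    \<open>w - \<tau> *\<^sub>R M w\<close>, the residual of that projection makes a nonacute angle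
    with every direction from \<open>w\<close> into \<open>S\<close>.\<close>
  have "0 \<le> M w \<bullet> (v - w)" if "v \<in> S" for v
  proof -
    have "(w - \<tau> *\<^sub>R M w - w) \<bullet> (v - w) \<le> 0"
      using closest_point_dot[OF S(2,1) that, of "w - \<tau> *\<^sub>R M w"] unfolding w(2) .
    then show ?thesis using \<tau> by (simp add: zero_le_mult_iff)
  qed
  with w(1) show thesis by (rule that)
qed

section \<open>Saddle functions with bilinear coupling\<close>

text \<open>Abstracts from \<open>F\<close> and \<open>f\<close>: \<open>P\<close> is to be
  \<open>F - \<rho> * f\<close>, evaluated at the maximizing variable, and \<open>Q\<close> is to be
  \<open>\<rho> * f\<close>, evaluated at the minimizing one. One constant \<open>L\<close> serves
  both gradients.\<close>

locale regularized_saddle =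
  fixes X :: "'a::euclidean_space set" and Y :: "'b::euclidean_space set"
    and P Q :: "'a \<times> 'b \<Rightarrow> real" and gP gQ :: "'a \<times> 'b \<Rightarrow> 'a \<times> 'b" and L \<sigma> \<delta> :: real
  assumes X: "convex X" and Y: "closed Y" "convex Y" "Y \<noteq> {}"
    and \<sigma>: "0 < \<sigma>" and \<delta>: "0 < \<delta>"
    and gP: "\<And>p. p \<in> X \<times> Y \<Longrightarrow> GDERIV P p :> gP p"
    and gQ: "\<And>p. p \<in> X \<times> Y \<Longrightarrow> GDERIV Q p :> gQ p"
    and lipP: "L-lipschitz_on (X \<times> Y) gP" and lipQ: "L-lipschitz_on (X \<times> Y) gQ"
    and P_concave: "\<And>x. x \<in> X \<Longrightarrow> concave_on Y (\<lambda>y. P (x, y))"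
    and Q_convex: "\<And>x. x \<in> X \<Longrightarrow> convex_on Y (\<lambda>z. Q (x, z))"
begin

section \<open>The saddle operator and its variational inequality\<close>

definition \<Psi> :: "'a \<Rightarrow> 'b \<Rightarrow> 'b \<Rightarrow> real" where
  "\<Psi> x y z = P (x, y) + Q (x, z) + \<sigma> / 2 * (norm z)\<^sup>2 - \<sigma> * (y \<bullet> z) - \<delta> / 2 * (norm y)\<^sup>2"

definition M :: "'a \<Rightarrow> 'b \<times> 'b \<Rightarrow> 'b \<times> 'b" where
  "M x w = (\<sigma> *\<^sub>R snd w + \<delta> *\<^sub>R fst w - snd (gP (x, fst w)),
    snd (gQ (x, snd w)) + \<sigma> *\<^sub>R snd w - \<sigma> *\<^sub>R fst w)"

text \<open>First-order conditions for a saddle point. Varying one component of \<open>v\<close> at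
  a time separates them into the condition for the maximum in \<open>y\<close> and the one for the
  minimum in \<open>z\<close>.\<close>

definition solution :: "'a \<Rightarrow> 'b \<times> 'b \<Rightarrow> bool" where
  "solution x w \<longleftrightarrow> w \<in> Y \<times> Y \<and> (\<forall>v\<in>Y \<times> Y. 0 \<le> M x w \<bullet> (v - w))"

lemma L_nonneg: "0 \<le> L"
  using lipP by (rule lipschitz_on_nonneg)

lemma gP_snd: "x \<in> X \<Longrightarrow> y \<in> Y \<Longrightarrow> GDERIV (\<lambda>y. P (x, y)) y :> snd (gP (x, y))"
  and gQ_snd: "x \<in> X \<Longrightarrow> y \<in> Y \<Longrightarrow> GDERIV (\<lambda>y. Q (x, y)) y :> snd (gQ (x, y))"
  by (auto intro!: GDERIV_Pair_snd gP gQ)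

lemma M_strongly_monotone:
  assumes x: "x \<in> X" and w: "w \<in> Y \<times> Y" "w' \<in> Y \<times> Y"
  shows "min \<sigma> \<delta> * (norm (w - w'))\<^sup>2 \<le> (M x w - M x w') \<bullet> (w - w')"
proof -
  obtain y z y' z' where [simp]: "w = (y, z)" "w' = (y', z')" by fastforce
  have 1: "(snd (gP (x, y)) - snd (gP (x, y'))) \<bullet> (y - y') \<le> 0"
    using w x by (auto intro: concave_on_gradient_antimono[OF P_concave gP_snd gP_snd])
  have 2: "0 \<le> (snd (gQ (x, z)) - snd (gQ (x, z'))) \<bullet> (z - z')"
    using w x by (auto intro: convex_on_gradient_mono[OF Q_convex gQ_snd gQ_snd])
  \<comment> \<open>The cross terms \<open>\<sigma> * ((z - z') \<bullet> (y - y'))\<close> of the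
    two components have opposite signs and cancel.\<close>
  have "(M x w - M x w') \<bullet> (w - w') =
     - ((snd (gP (x, y)) - snd (gP (x, y'))) \<bullet> (y - y')) + \<delta> * (norm (y - y'))\<^sup>2
     + (snd (gQ (x, z)) - snd (gQ (x, z'))) \<bullet> (z - z') + \<sigma> * (norm (z - z'))\<^sup>2"
    by (simp only: power2_norm_eq_inner)
      (simp add: M_def inner_prod_def inner_commute algebra_simps)
  also have "\<dots> \<ge> min \<sigma> \<delta> * (norm (y - y'))\<^sup>2 + min \<sigma> \<delta> * (norm (z - z'))\<^sup>2"
    using 1 2 mult_right_mono[of "min \<sigma> \<delta>" \<delta> "(norm (y - y'))\<^sup>2"]
      mult_right_mono[of "min \<sigma> \<delta>" \<sigma> "(norm (z - z'))\<^sup>2"] by simp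
  also have "min \<sigma> \<delta> * (norm (y - y'))\<^sup>2 + min \<sigma> \<delta> * (norm (z - z'))\<^sup>2
      = min \<sigma> \<delta> * (norm (w - w'))\<^sup>2"
    by (simp add: norm_Pair algebra_simps)
  finally show ?thesis .
qed

text \<open>The first component of \<open>M\<close> contributes
  \<open>L + \<sigma> + \<delta>\<close>, the second \<open>L + 2 * \<sigma>\<close>.\<close>

definition K :: real where "K = 2 * L + 3 * \<sigma> + \<delta>"

lemma snd_gradient_lipschitz:
  fixes g :: "'a \<times> 'b \<Rightarrow> 'a \<times> 'b"
  assumes "L-lipschitz_on (X \<times> Y) g" "x \<in> X" "x' \<in> X" "y \<in> Y" "y' \<in> Y"
  shows "norm (snd (g (x, y)) - snd (g (x', y'))) \<le> L * (norm (x - x') + norm (y - y'))"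
proof -
  have "norm (snd (g (x, y)) - snd (g (x', y'))) \<le> norm (g (x, y) - g (x', y'))"
    by (metis norm_snd_le prod.collapse snd_diff)
  also have "\<dots> \<le> L * norm ((x, y) - (x', y'))"
    using assms by (intro lipschitz_on_normD) auto
  also have "\<dots> \<le> L * (norm (x - x') + norm (y - y'))"
    using norm_Pair_le[of "x - x'" "y - y'"] L_nonneg by (auto intro: mult_left_mono)
  finally show ?thesis .
qed

text \<open>The estimate is joint in both arguments: \<open>x = x'\<close> serves the existence of
  solutions, \<open>w = w'\<close> their stability in \<open>x\<close>.\<close>

lemma M_lipschitz:
  assumes "x \<in> X" "x' \<in> X" "w \<in> Y \<times> Y" "w' \<in> Y \<times> Y"
  shows "norm (M x w - M x' w') \<le> K * (norm (x - x') + norm (w - w'))"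
proof -
  obtain y z y' z' where [simp]: "w = (y, z)" "w' = (y', z')" by fastforce
  let ?a = "snd (gP (x, y)) - snd (gP (x', y'))" and ?b = "snd (gQ (x, z)) - snd (gQ (x', z'))"
  have yz: "norm (y - y') \<le> norm (w - w')" "norm (z - z') \<le> norm (w - w')"
    using norm_fst_le[of "y - y'" "z - z'"] norm_snd_le[of "z - z'" "y - y'"] by auto
  have a: "norm ?a \<le> L * (norm (x - x') + norm (w - w'))"
    using assms yz L_nonneg
    by (intro order_trans[OF snd_gradient_lipschitz[OF lipP]] mult_left_mono add_mono) auto
  have b: "norm ?b \<le> L * (norm (x - x') + norm (w - w'))"
    using assms yz L_nonneg
    by (intro order_trans[OF snd_gradient_lipschitz[OF lipQ]] mult_left_mono add_mono) auto
  have "M x w - M x' w' = (\<sigma> *\<^sub>R (z - z') + \<delta> *\<^sub>R (y - y') - ?a, ?b + \<sigma> *\<^sub>R (z - z') - \<sigma> *\<^sub>R (y - y'))"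
    by (simp add: M_def algebra_simps)
  also have "norm \<dots> \<le> norm (\<sigma> *\<^sub>R (z - z') + \<delta> *\<^sub>R (y - y') - ?a)
      + norm (?b + \<sigma> *\<^sub>R (z - z') - \<sigma> *\<^sub>R (y - y'))"
    by (rule norm_Pair_le)
  also have "\<dots> \<le> (\<sigma> * norm (z - z') + \<delta> * norm (y - y') + norm ?a)
      + (norm ?b + \<sigma> * norm (z - z') + \<sigma> * norm (y - y'))"
    using \<sigma> \<delta> by (intro add_mono norm_triangle_le norm_triangle_le_diff order_refl) auto
  also have "\<dots> \<le> (\<sigma> * norm (w - w') + \<delta> * norm (w - w') + L * (norm (x - x') + norm (w - w')))
      + (L * (norm (x - x') + norm (w - w')) + \<sigma> * norm (w - w') + \<sigma> * norm (w - w'))"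
    using yz a b \<sigma> \<delta> by (intro add_mono mult_left_mono) auto
  also have "\<dots> \<le> K * (norm (x - x') + norm (w - w'))"
    using \<sigma> \<delta> unfolding K_def by (simp add: algebra_simps)
  finally show ?thesis .
qed

lemma K_pos: "0 < K"
  using L_nonneg \<sigma> \<delta> by (simp add: K_def)

lemma solution_exists:
  assumes x: "x \<in> X"
  obtains y z where "solution x (y, z)"
proof -
  have "K-lipschitz_on (Y \<times> Y) (M x)"
    using M_lipschitz[OF x x] K_pos by (intro lipschitz_onI) (auto simp: dist_norm)
  moreover have "closed (Y \<times> Y)" "convex (Y \<times> Y)" "Y \<times> Y \<noteq> {}" "0 < min \<sigma> \<delta>"
    using Y \<sigma> \<delta> by (auto intro: closed_Times convex_Times)
  ultimately obtain w where "solution x w"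
    using M_strongly_monotone[OF x] strongly_monotone_variational_inequality
    unfolding solution_def by metis
  then show thesis by (cases w) (blast intro: that)
qed

text \<open>Each variational inequality is tested with the solution of the other. Their sum and
  strong monotonicity bound \<open>min \<sigma> \<delta> * (norm (w - w'))\<^sup>2\<close> by the
  change of \<open>M\<close> in \<open>x\<close> alone, and one factor \<open>norm (w - w')\<close>
  cancels.\<close>

lemma solution_lipschitz:
  assumes x: "x \<in> X" "x' \<in> X" and w: "solution x w" "solution x' w'"
  shows "norm (w' - w) \<le> K / min \<sigma> \<delta> * norm (x' - x)"
proof -
  let ?\<mu> = "min \<sigma> \<delta>"
  have wY: "w \<in> Y \<times> Y" "w' \<in> Y \<times> Y" using w by (auto simp: solution_def)
  have "0 \<le> M x w \<bullet> (w' - w)" "0 \<le> M x' w' \<bullet> (w - w')"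
    using w wY unfolding solution_def by blast+
  then have "(M x' w' - M x w') \<bullet> (w - w') \<ge> (M x w - M x w') \<bullet> (w - w')"
    by (simp add: inner_diff_left inner_diff_right)
  then have "?\<mu> * (norm (w - w'))\<^sup>2 \<le> (M x' w' - M x w') \<bullet> (w - w')"
    using M_strongly_monotone[OF x(1) wY] by linarith
  also have "\<dots> \<le> norm (M x' w' - M x w') * norm (w - w')"
    by (rule norm_cauchy_schwarz)
  also have "\<dots> \<le> K * norm (x' - x) * norm (w - w')"
    using M_lipschitz[OF x(2,1) wY(2,2)] by (intro mult_right_mono) auto
  finally have "norm (w - w') * (?\<mu> * norm (w - w')) \<le> norm (w - w') * (K * norm (x' - x))"
    by (simp add: power2_eq_square algebra_simps)
  then have "?\<mu> * norm (w - w') \<le> K * norm (x' - x)"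
    using K_pos by (cases "w = w'") (auto simp: mult_le_cancel_left)
  then show ?thesis
    using \<sigma> \<delta> by (simp add: field_simps norm_minus_commute)
qed

section \<open>Saddle points and the minimax value\<close>

text \<open>\<open>P\<close> and \<open>Q\<close> are replaced by their tangents and the
  regularizing terms are expanded exactly. The variational inequality, tested with
  \<open>(y', z)\<close> or \<open>(y, z')\<close>, disposes of the linear part, and the square
  remains as a gap. The gaps yield uniqueness and boundedness below.\<close>

lemma solution_saddle:
  assumes x: "x \<in> X" and w: "solution x (y, z)"
  shows "y' \<in> Y \<Longrightarrow> \<Psi> x y' z \<le> \<Psi> x y z - \<delta> / 2 * (norm (y' - y))\<^sup>2"
    and "z' \<in> Y \<Longrightarrow> \<Psi> x y z + \<sigma> / 2 * (norm (z' - z))\<^sup>2 \<le> \<Psi> x y z'"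
proof -
  have yz: "y \<in> Y" "z \<in> Y" using w by (auto simp: solution_def)
  have vi: "0 \<le> M x (y, z) \<bullet> (v - (y, z))" if "v \<in> Y \<times> Y" for v
    using w that by (auto simp: solution_def)
  show "\<Psi> x y' z \<le> \<Psi> x y z - \<delta> / 2 * (norm (y' - y))\<^sup>2" if y': "y' \<in> Y"
  proof -
    have "P (x, y') \<le> P (x, y) + (y' - y) \<bullet> snd (gP (x, y))"
      using x yz y' by (intro concave_on_below_gradient[OF P_concave] gP_snd)
    moreover have "0 \<le> (\<sigma> *\<^sub>R z + \<delta> *\<^sub>R y - snd (gP (x, y))) \<bullet> (y' - y)"
      using vi[of "(y', z)"] y' yz by (simp add: M_def)
    ultimately show ?thesis
      unfolding \<Psi>_def power2_norm_eq_inner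
      by (simp add: algebra_simps inner_commute add_divide_distrib diff_divide_distrib)
  qed
  show "\<Psi> x y z + \<sigma> / 2 * (norm (z' - z))\<^sup>2 \<le> \<Psi> x y z'" if z': "z' \<in> Y"
  proof -
    have "Q (x, z) + (z' - z) \<bullet> snd (gQ (x, z)) \<le> Q (x, z')"
      using x yz z' by (intro convex_on_above_gradient[OF Q_convex] gQ_snd)
    moreover have "0 \<le> (snd (gQ (x, z)) + \<sigma> *\<^sub>R z - \<sigma> *\<^sub>R y) \<bullet> (z' - z)"
      using vi[of "(y, z')"] z' yz by (simp add: M_def)
    ultimately show ?thesis
      unfolding \<Psi>_def power2_norm_eq_inner
      by (simp add: algebra_simps inner_commute add_divide_distrib diff_divide_distrib)
  qed
qed

lemma solution_is_saddle_point:
  assumes x: "x \<in> X" and w: "solution x w"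
  shows "is_saddle_point Y (\<Psi> x) w"
proof -
  obtain y z where wyz: "w = (y, z)" by fastforce
  have "y \<in> Y" "z \<in> Y" using w by (auto simp: solution_def wyz)
  moreover have "\<Psi> x y' z \<le> \<Psi> x y z" if "y' \<in> Y" for y'
    using \<delta> by (intro order_trans[OF solution_saddle(1)[OF x w[unfolded wyz] that]]) simp
  moreover have "\<Psi> x y z \<le> \<Psi> x y z'" if "z' \<in> Y" for z'
    using \<sigma> by (intro order_trans[OF _ solution_saddle(2)[OF x w[unfolded wyz] that]]) simp
  ultimately show ?thesis
    by (auto simp: is_saddle_point_def wyz)
qed

lemma saddle_point_unique:
  assumes x: "x \<in> X" and w: "solution x w" and p: "is_saddle_point Y (\<Psi> x) p"
  shows "p = w"
proof -
  obtain y z y' z' where [simp]: "w = (y, z)" "p = (y', z')" by fastforce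
  have w': "y \<in> Y" "z \<in> Y" using w by (auto simp: solution_def)
  have p': "y' \<in> Y" "z' \<in> Y" "\<Psi> x y z' \<le> \<Psi> x y' z'" "\<Psi> x y' z' \<le> \<Psi> x y' z"
    using p w' by (auto simp: is_saddle_point_def)
  \<comment> \<open>The chain passes through \<open>\<Psi> x y z'\<close>,
    \<open>\<Psi> x y' z'\<close> and \<open>\<Psi> x y' z\<close>; the outer steps are the
    quadratic gaps, the inner ones the saddle property of \<open>p\<close>. Both squares must
    therefore vanish.\<close>
  have "\<Psi> x y z + \<sigma> / 2 * (norm (z' - z))\<^sup>2 \<le> \<Psi> x y z - \<delta> / 2 * (norm (y' - y))\<^sup>2"
    using solution_saddle[OF x, of y z] w p' by fastforce
  moreover have "0 \<le> \<sigma> / 2 * (norm (z' - z))\<^sup>2" "0 \<le> \<delta> / 2 * (norm (y' - y))\<^sup>2"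
    using \<sigma> \<delta> by auto
  ultimately have "\<sigma> / 2 * (norm (z' - z))\<^sup>2 = 0" "\<delta> / 2 * (norm (y' - y))\<^sup>2 = 0"
    by linarith+
  then show ?thesis using \<sigma> \<delta> by simp
qed

text \<open>Replacing \<open>z\<close> by \<open>z'\<close> changes \<open>\<Psi> x y' z\<close> by
  an affine function of \<open>y'\<close>, which the gap
  \<open>- \<delta> / 2 * (norm (y' - y))\<^sup>2\<close> at the saddle point dominates. The bound
  makes the real-valued \<open>SUP\<close> a genuine supremum for every \<open>z'\<close>.\<close>

lemma bdd_above_\<Psi>:
  assumes x: "x \<in> X" and z': "z' \<in> Y"
  shows "bdd_above ((\<lambda>y. \<Psi> x y z') ` Y)"
proof -
  obtain y z where w: "solution x (y, z)" by (rule solution_exists[OF x])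
  define e where "e = z' - z"
  define C where "C = \<Psi> x y z + Q (x, z') + \<sigma> / 2 * (norm z')\<^sup>2 - Q (x, z) - \<sigma> / 2 * (norm z)\<^sup>2
    - \<sigma> * (y \<bullet> e) + \<sigma>\<^sup>2 * (norm e)\<^sup>2 / (2 * \<delta>)"
  have "\<Psi> x y' z' \<le> C" if "y' \<in> Y" for y'
  proof -
    define d where "d = y' - y"
    text \<open>Completing the square in \<open>d\<close>.\<close>
    have "0 \<le> (norm (\<delta> *\<^sub>R d + \<sigma> *\<^sub>R e))\<^sup>2 / (2 * \<delta>)" using \<delta> by simp
    also have "\<dots> = \<delta> / 2 * (norm d)\<^sup>2 + \<sigma> * (d \<bullet> e) + \<sigma>\<^sup>2 * (norm e)\<^sup>2 / (2 * \<delta>)"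
      using \<delta> by (simp only: power2_norm_eq_inner)
        (simp add: inner_add_left inner_add_right inner_commute field_simps power2_eq_square)
    finally have "- \<sigma> * (d \<bullet> e) - \<delta> / 2 * (norm d)\<^sup>2 \<le> \<sigma>\<^sup>2 * (norm e)\<^sup>2 / (2 * \<delta>)" by simp
    moreover have "\<Psi> x y' z \<le> \<Psi> x y z - \<delta> / 2 * (norm d)\<^sup>2"
      using solution_saddle(1)[OF x w that] by (simp add: d_def)
    moreover have "\<Psi> x y' z' = \<Psi> x y' z + Q (x, z') + \<sigma> / 2 * (norm z')\<^sup>2 - Q (x, z)
        - \<sigma> / 2 * (norm z)\<^sup>2 - \<sigma> * (y \<bullet> e) - \<sigma> * (d \<bullet> e)"
      by (simp add: \<Psi>_def d_def e_def algebra_simps)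
    ultimately show ?thesis by (simp add: C_def)
  qed
  then show ?thesis by (auto simp: bdd_above_def)
qed

text \<open>At the saddle \<open>z\<close> the supremum is attained at \<open>y\<close>. For any
  other \<open>z'\<close> it is at least \<open>\<Psi> x y z'\<close>, hence at least the saddle
  value.\<close>

lemma INF_SUP_eq_saddle_value:
  assumes x: "x \<in> X" and w: "solution x (y, z)"
  shows "(INF z\<in>Y. SUP y\<in>Y. \<Psi> x y z) = \<Psi> x y z"
proof (rule cInf_eq_minimum)
  have yz: "y \<in> Y" "z \<in> Y" using w by (auto simp: solution_def)
  have s: "\<Psi> x y' z \<le> \<Psi> x y z" "\<Psi> x y z \<le> \<Psi> x y y'" if "y' \<in> Y" for y'
    using solution_is_saddle_point[OF x w] that by (auto simp: is_saddle_point_def)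
  have "(SUP y\<in>Y. \<Psi> x y z) = \<Psi> x y z"
    using yz s by (intro cSup_eq_maximum) auto
  then show "\<Psi> x y z \<in> (\<lambda>z. SUP y\<in>Y. \<Psi> x y z) ` Y"
    using yz by (intro image_eqI[of _ _ z]) simp_all
  show "\<Psi> x y z \<le> v" if "v \<in> (\<lambda>z. SUP y\<in>Y. \<Psi> x y z) ` Y" for v
  proof -
    from that obtain z' where z': "z' \<in> Y" "v = (SUP y\<in>Y. \<Psi> x y z')" by blast
    have "\<Psi> x y z \<le> \<Psi> x y z'" using s z' by simp
    also have "\<dots> \<le> v"
      unfolding z'(2) using yz bdd_above_\<Psi>[OF x z'(1)] by (intro cSUP_upper)
    finally show ?thesis .
  qed
qed

section \<open>Differentiability of the minimax value\<close>

text \<open>The regularizing terms do not involve \<open>x\<close> and cancel, leaving the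
  increments of \<open>P\<close> and \<open>Q\<close>. The linear form stays at
  \<open>(y, z)\<close> while the increment is taken at \<open>(u, v)\<close>.\<close>

lemma \<Psi>_increment:
  assumes "x \<in> X" "x' \<in> X" "y \<in> Y" "z \<in> Y" "u \<in> Y" "v \<in> Y"
  shows "\<bar>\<Psi> x' u v - \<Psi> x u v - (x' - x) \<bullet> (fst (gP (x, y)) + fst (gQ (x, z)))\<bar>
    \<le> L * (2 * norm (x' - x) + norm (u - y) + norm (v - z)) * norm (x' - x)"
proof -
  note inc = lipschitz_gradient_partial_increment[OF X assms(1,2)]
  have "\<bar>P (x', u) - P (x, u) - (x' - x) \<bullet> fst (gP (x, y))\<bar>
      \<le> L * (norm (x' - x) + norm (u - y)) * norm (x' - x)"
    using assms gP lipP by (intro inc[of y Y u P gP L])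
  moreover have "\<bar>Q (x', v) - Q (x, v) - (x' - x) \<bullet> fst (gQ (x, z))\<bar>
      \<le> L * (norm (x' - x) + norm (v - z)) * norm (x' - x)"
    using assms gQ lipQ by (intro inc[of z Y v Q gQ L])
  moreover have "\<Psi> x' u v - \<Psi> x u v - (x' - x) \<bullet> (fst (gP (x, y)) + fst (gQ (x, z)))
      = (P (x', u) - P (x, u) - (x' - x) \<bullet> fst (gP (x, y)))
        + (Q (x', v) - Q (x, v) - (x' - x) \<bullet> fst (gQ (x, z)))"
    by (simp add: \<Psi>_def inner_add_right)
  moreover have "L * (2 * norm (x' - x) + norm (u - y) + norm (v - z)) * norm (x' - x)
      = L * (norm (x' - x) + norm (u - y)) * norm (x' - x)
        + L * (norm (x' - x) + norm (v - z)) * norm (x' - x)"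
    by (simp add: distrib_left distrib_right)
  ultimately show ?thesis by linarith
qed

lemma INF_SUP_has_derivative:
  assumes x: "x \<in> X" and w: "solution x (y, z)"
  shows "((\<lambda>x. INF z\<in>Y. SUP y\<in>Y. \<Psi> x y z) has_derivative
    (\<lambda>h. h \<bullet> (fst (gP (x, y)) + fst (gQ (x, z))))) (at x within X)"
proof -
  define V where "V = (\<lambda>x. INF z\<in>Y. SUP y\<in>Y. \<Psi> x y z)"
  define D where "D = fst (gP (x, y)) + fst (gQ (x, z))"
  define R where "R = K / min \<sigma> \<delta>"
  \<comment> \<open>This is \<open>L * (2 + R + R)\<close>: the factor from
    \<open>\<Psi>_increment\<close> once both components have moved by at most
    \<open>R * norm (x' - x)\<close>.\<close>
  define C where "C = 2 * L * (1 + R)"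
  have R0: "0 \<le> R" using K_pos \<sigma> \<delta> by (simp add: R_def)
  have C0: "0 \<le> C" using L_nonneg R0 by (simp add: C_def)
  have yz: "y \<in> Y" "z \<in> Y" using w by (auto simp: solution_def)
  have quad: "\<bar>V x' - V x - (x' - x) \<bullet> D\<bar> \<le> C * norm (x' - x) * norm (x' - x)" if x': "x' \<in> X" for x'
  proof -
    obtain y' z' where w': "solution x' (y', z')" by (rule solution_exists[OF x'])
    have yz': "y' \<in> Y" "z' \<in> Y" using w' by (auto simp: solution_def)
    have V: "V x = \<Psi> x y z" "V x' = \<Psi> x' y' z'"
      unfolding V_def using INF_SUP_eq_saddle_value x x' w w' by auto
    have "norm ((y', z') - (y, z)) \<le> R * norm (x' - x)"
      unfolding R_def by (rule solution_lipschitz[OF x x' w w'])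
    then have d: "norm (y' - y) \<le> R * norm (x' - x)" "norm (z' - z) \<le> R * norm (x' - x)"
      using norm_fst_le[of "y' - y" "z' - z"] norm_snd_le[of "z' - z" "y' - y"] by auto
    have bound: "\<bar>\<Psi> x' u v - \<Psi> x u v - (x' - x) \<bullet> D\<bar> \<le> C * norm (x' - x) * norm (x' - x)"
      if uv: "u \<in> Y" "v \<in> Y" "norm (u - y) \<le> R * norm (x' - x)" "norm (v - z) \<le> R * norm (x' - x)"
      for u v
    proof -
      have "\<bar>\<Psi> x' u v - \<Psi> x u v - (x' - x) \<bullet> D\<bar>
          \<le> L * (2 * norm (x' - x) + norm (u - y) + norm (v - z)) * norm (x' - x)"
        unfolding D_def by (rule \<Psi>_increment[OF x x' yz uv(1,2)])
      also have "\<dots> \<le> L * (2 * norm (x' - x) + R * norm (x' - x) + R * norm (x' - x)) * norm (x' - x)"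
        using uv L_nonneg by (intro mult_right_mono mult_left_mono add_mono) auto
      also have "\<dots> = C * norm (x' - x) * norm (x' - x)"
        by (simp add: C_def algebra_simps)
      finally show ?thesis .
    qed
    \<comment> \<open>Mixed points give the sandwich: \<open>V x' - V x\<close> is at most the
      increment of \<open>\<Psi>\<close> at \<open>(y', z)\<close> and at least the one at
      \<open>(y, z')\<close>.\<close>
    have s: "\<Psi> x y' z \<le> \<Psi> x y z" "\<Psi> x y z \<le> \<Psi> x y z'"
      using solution_is_saddle_point[OF x w] yz' by (auto simp: is_saddle_point_def)
    have s': "\<Psi> x' y z' \<le> \<Psi> x' y' z'" "\<Psi> x' y' z' \<le> \<Psi> x' y' z"
      using solution_is_saddle_point[OF x' w'] yz by (auto simp: is_saddle_point_def)
    have "\<bar>\<Psi> x' y' z - \<Psi> x y' z - (x' - x) \<bullet> D\<bar> \<le> C * norm (x' - x) * norm (x' - x)"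
      using bound[of y' z] yz yz' d R0 by simp
    moreover have "\<bar>\<Psi> x' y z' - \<Psi> x y z' - (x' - x) \<bullet> D\<bar> \<le> C * norm (x' - x) * norm (x' - x)"
      using bound[of y z'] yz yz' d R0 by simp
    ultimately show ?thesis
      unfolding V using s s' by linarith
  qed
  have "(V has_derivative (\<lambda>h. h \<bullet> D)) (at x within X)"
    unfolding has_derivative_within_alt
  proof (intro conjI allI impI)
    show "bounded_linear (\<lambda>h. h \<bullet> D)" by (rule bounded_linear_inner_left)
    fix e :: real assume e: "0 < e"
    show "\<exists>d>0. \<forall>x'\<in>X. norm (x' - x) < d \<longrightarrow>
        norm (V x' - V x - (x' - x) \<bullet> D) \<le> e * norm (x' - x)"
    \<comment> \<open>The summand 1 keeps the denominator positive when
      \<open>C = 0\<close>.\<close>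
    proof (intro exI[of _ "e / (C + 1)"] conjI ballI impI)
      show "0 < e / (C + 1)" using e C0 by simp
      fix x' assume x': "x' \<in> X" "norm (x' - x) < e / (C + 1)"
      have "C * norm (x' - x) \<le> (C + 1) * norm (x' - x)" by (simp add: algebra_simps)
      also have "\<dots> \<le> e" using x'(2) C0 by (simp add: field_simps)
      finally have "C * norm (x' - x) * norm (x' - x) \<le> e * norm (x' - x)"
        by (rule mult_right_mono) simp
      then show "norm (V x' - V x - (x' - x) \<bullet> D) \<le> e * norm (x' - x)"
        using quad[OF x'(1)] by simp
    qed
  qed
  then show ?thesis by (simp add: V_def D_def)
qed

end

section \<open>Specialization to the regularized bilevel function\<close>

theorem theorem1:
  fixes X :: "(real ^ 'n) set" and Y :: "(real ^ 'm) set"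
    and F f :: "(real ^ 'n) \<times> (real ^ 'm) \<Rightarrow> real"
    and \<rho> \<sigma> \<delta> :: real
  assumes "X \<noteq> {}" and "closed X" and "convex X"
    and "Y \<noteq> {}" and "closed Y" and "convex Y"
    and "assumption_A1 X Y F"
    and "assumption_A2 X Y f"
    and "\<rho> > 0" and "\<sigma> > 0" and "\<delta> > 0"
  shows "\<forall>x\<in>X.
    (\<exists>!p. is_saddle_point Y (psi F f \<rho> \<sigma> \<delta> x) p) \<and>
    has_gradient_within (phi Y F f \<rho> \<sigma> \<delta>)
      (gradient_x F x (y_star Y F f \<rho> \<sigma> \<delta> x)
        - \<rho> *\<^sub>R gradient_x f x (y_star Y F f \<rho> \<sigma> \<delta> x)
        + \<rho> *\<^sub>R gradient_x f x (z_star Y F f \<rho> \<sigma> \<delta> x))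
      x X"
proof
  fix x assume x: "x \<in> X"
  note A1 = \<open>assumption_A1 X Y F\<close>[unfolded assumption_A1_def continuously_differentiable_def]
  note A2 = \<open>assumption_A2 X Y f\<close>[unfolded assumption_A2_def continuously_differentiable_def]
  from A1 obtain LF where LF: "LF-lipschitz_on (X \<times> Y) (gradient F)" by blast
  from A2 obtain Lf where Lf: "Lf-lipschitz_on (X \<times> Y) (gradient f)" by blast
  have nonneg: "0 \<le> LF" "0 \<le> Lf" using LF Lf lipschitz_on_nonneg by auto
  have dF: "F differentiable (at p)" and df: "f differentiable (at p)" for p
    using A1 A2 by blast+
  note F' = GDERIV_gradient[OF dF] and f' = GDERIV_gradient[OF df]
  \<comment> \<open>Moving \<open>- \<rho> * f (x, y)\<close> into \<open>P\<close> preserves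
    concavity in \<open>y\<close>, because \<open>f\<close> is convex there and
    \<open>\<rho>\<close> is positive.\<close>
  interpret regularized_saddle X Y "\<lambda>p. F p - \<rho> * f p" "\<lambda>p. \<rho> * f p"
    "\<lambda>p. gradient F p - \<rho> *\<^sub>R gradient f p" "\<lambda>p. \<rho> *\<^sub>R gradient f p" "LF + \<rho> * Lf" \<sigma> \<delta>
  proof
    have \<rho>f': "GDERIV (\<lambda>p. \<rho> * f p) p :> \<rho> *\<^sub>R gradient f p" for p
      using f'[of p] unfolding gderiv_def by (auto intro!: derivative_eq_intros)
    show "GDERIV (\<lambda>p. \<rho> * f p) p :> \<rho> *\<^sub>R gradient f p"
      "GDERIV (\<lambda>p. F p - \<rho> * f p) p :> gradient F p - \<rho> *\<^sub>R gradient f p" for p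
      by (intro \<rho>f' GDERIV_diff F')+
    have \<rho>Lf: "(\<rho> * Lf)-lipschitz_on (X \<times> Y) (\<lambda>p. \<rho> *\<^sub>R gradient f p)"
      using Lf \<open>\<rho> > 0\<close> by (intro lipschitz_on_cmult_nonneg) auto
    then show "(LF + \<rho> * Lf)-lipschitz_on (X \<times> Y) (\<lambda>p. \<rho> *\<^sub>R gradient f p)"
      using nonneg by (auto intro: lipschitz_on_le)
    show "(LF + \<rho> * Lf)-lipschitz_on (X \<times> Y) (\<lambda>p. gradient F p - \<rho> *\<^sub>R gradient f p)"
      using LF \<rho>Lf by (rule lipschitz_on_diff)
    fix x assume "x \<in> X"
    then have cF: "concave_on Y (\<lambda>y. F (x, y))" and cf: "convex_on Y (\<lambda>y. f (x, y))"
      using A1 A2 by auto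
    show "convex_on Y (\<lambda>y. \<rho> * f (x, y))"
      using cf \<open>\<rho> > 0\<close> by (intro convex_on_cmul) auto
    then show "concave_on Y (\<lambda>y. F (x, y) - \<rho> * f (x, y))"
      using convex_on_add[OF cF[unfolded concave_on_def]] by (simp add: concave_on_def)
  qed (use assms in auto)
  have psi: "psi F f \<rho> \<sigma> \<delta> = \<Psi>"
    by (intro ext) (simp add: psi_def \<Psi>_def right_diff_distrib)
  obtain y z where w: "solution x (y, z)" by (rule solution_exists[OF x])
  have sad: "is_saddle_point Y (\<Psi> x) (y, z)" using x w by (rule solution_is_saddle_point)
  moreover have uniq: "p = (y, z)" if "is_saddle_point Y (\<Psi> x) p" for p
    using x w that by (rule saddle_point_unique)
  ultimately have "saddle_point Y F f \<rho> \<sigma> \<delta> x = (y, z)"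
    unfolding saddle_point_def psi by (rule the_equality)
  then have star: "y_star Y F f \<rho> \<sigma> \<delta> x = y" "z_star Y F f \<rho> \<sigma> \<delta> x = z"
    by (simp_all add: y_star_def z_star_def)
  have "phi Y F f \<rho> \<sigma> \<delta> = (\<lambda>x. INF z\<in>Y. SUP y\<in>Y. \<Psi> x y z)"
    by (intro ext) (simp add: phi_def psi)
  \<comment> \<open>Partial gradients are first components of full gradients, which matches the
    derivative from the locale with the claimed formula.\<close>
  moreover have "gradient_x F x u = fst (gradient F (x, u))"
    "gradient_x f x u = fst (gradient f (x, u))" for u
    by (intro gradient_x_eq dF df)+
  ultimately have "has_gradient_within (phi Y F f \<rho> \<sigma> \<delta>)
      (gradient_x F x y - \<rho> *\<^sub>R gradient_x f x y + \<rho> *\<^sub>R gradient_x f x z) x X"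
    using INF_SUP_has_derivative[OF x w] by (simp add: has_gradient_within_def)
  with sad uniq show "(\<exists>!p. is_saddle_point Y (psi F f \<rho> \<sigma> \<delta> x) p) \<and>
    has_gradient_within (phi Y F f \<rho> \<sigma> \<delta>)
      (gradient_x F x (y_star Y F f \<rho> \<sigma> \<delta> x)
        - \<rho> *\<^sub>R gradient_x f x (y_star Y F f \<rho> \<sigma> \<delta> x)
        + \<rho> *\<^sub>R gradient_x f x (z_star Y F f \<rho> \<sigma> \<delta> x))
      x X"
    unfolding psi star by blast
qed

end
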